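(* Let $n\ge1$ be an integer, let $r\in(0,1)$ be the unique solution in $(0,1)$ of $r^n(1+n(1+r))=1$, and put $h=1+r$. Let $f:\mathbb{R}^d\to\mathbb{R}$ be convex and $1$-smooth with $0\in\arg\min f$ and $f(0)=0$, and let $\varphi$ be obtained from $f$ as in the context. Then every relaxed proximal point trajectory $$y_i=\operatorname{prox}_{\varphi}(x_i)\ (0\le i\le n),\qquad x_{i+1}=x_i-h(x_i-y_i)\ (0\le i\le n-1),$$ with arbitrary $x_0\in\mathbb{R}^d$, satisfies $$\frac12\|x_n\|^2+nh\,\varphi(y_n)+nh\left(1+\frac{nh}{2}\right)\|g_n\|^2\le\frac12\|x_0\|^2,$$ where $g_n=\nabla f(x_n)=x_n-y_n$.
   Context: $\|\cdot\|$ is the Euclidean norm; $1$-smooth means differentiable with $1$-Lipschitz gradient. Given $f$, let $f^*$ be its Fenchel conjugate, $f^*(g)=\sup_x\{\langle g,x\rangle-f(x)\}$, and define $$\psi(g)=f^*(g)-\frac12\|g\|^2,\qquad \varphi=\psi^* .$$ Since $f$ is $1$-smooth and convex, $f^*$ is $1$-strongly convex, so $\psi$ is convex. The proximal map is $\operatorname{prox}_\varphi(x)=\arg\min_y\{\varphi(y)+\frac12\|y-x\|^2\}$. With $g_i=\nabla f(x_i)$ one has $\operatorname{prox}_\varphi(x_i)=y_i=x_i-g_i$, so the trajectory coincides with gradient descent $x_{i+1}=x_i-h\nabla f(x_i)$. *)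

theory Defs
  imports "HOL-Analysis.Analysis"
begin

definition grad :: "('a::real_inner \<Rightarrow> real) \<Rightarrow> 'a \<Rightarrow> 'a"
  where "grad f x = (THE g. GDERIV f x :> g)"

definition L_smooth :: "real \<Rightarrow> ('a::real_inner \<Rightarrow> real) \<Rightarrow> bool"
  where "L_smooth L f \<longleftrightarrow> (\<forall>x. f differentiable (at x)) \<and> L-lipschitz_on UNIV (grad f)"

text \<open>Conjugates take values in the extended reals: even for finite \<open>f\<close>, both \<open>f\<^sup>*\<close> and
  \<open>\<phi>\<close> below may be \<open>\<infinity>\<close> at some points.\<close>

definition fenchel_conjugate :: "('a::real_inner \<Rightarrow> ereal) \<Rightarrow> 'a \<Rightarrow> ereal"
  where "fenchel_conjugate F g = (SUP x. ereal (g \<bullet> x) - F x)"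

definition prox_psi :: "('a::real_inner \<Rightarrow> real) \<Rightarrow> 'a \<Rightarrow> ereal"
  where "prox_psi f g = fenchel_conjugate (\<lambda>x. ereal (f x)) g - ereal (1/2 * (norm g)\<^sup>2)"

definition prox_phi :: "('a::real_inner \<Rightarrow> real) \<Rightarrow> 'a \<Rightarrow> ereal"
  where "prox_phi f = fenchel_conjugate (prox_psi f)"

text \<open>\<open>arg_min\<close> is a choice of minimiser, unspecified if none exists; for \<open>\<phi> = prox_phi f\<close> with
  \<open>f\<close> convex and 1-smooth the minimiser exists and is unique.\<close>

definition prox :: "('a::real_inner \<Rightarrow> ereal) \<Rightarrow> 'a \<Rightarrow> 'a"
  where "prox \<phi> x = arg_min (\<lambda>y. \<phi> y + ereal (1/2 * (norm (y - x))\<^sup>2)) (\<lambda>_. True)"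

end

theory Submission imports Defs begin

text \<open>
  Write \<open>p\<^sub>i = \<phi>(y\<^sub>i)\<close>. Since \<open>g\<^sub>i\<close> is a subgradient of \<open>\<phi>\<close> at \<open>y\<^sub>i\<close> and \<open>\<phi>(0) = 0\<close>, one has
  \<open>\<langle>g\<^sub>i, y\<^sub>i\<rangle> \<ge> p\<^sub>i\<close>. Adding this up along the trajectory reduces the claim to
  \<open>\<Sum>i<n. (p\<^sub>i - p\<^sub>n + (1 - r)/2 |g\<^sub>i|\<^sup>2) \<ge> n (1 + nh/2) |g\<^sub>n|\<^sup>2\<close>.
  The difference of the two sides is exactly a nonnegative combination of the subgradient
  inequalities \<open>p\<^sub>i \<ge> p\<^sub>j + \<langle>g\<^sub>j, y\<^sub>i - y\<^sub>j\<rangle>\<close> with separable weights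
  \<open>(C\<^sub>j + r C\<^sub>j\<^sub>+\<^sub>1) (B\<^sub>i\<^sub>-\<^sub>1 - B\<^sub>i)\<close> for \<open>i > j\<close> and \<open>(B\<^sub>j\<^sub>-\<^sub>1 + r B\<^sub>j) (C\<^sub>i\<^sub>+\<^sub>1 - C\<^sub>i)\<close> for \<open>i < j\<close>.
  Let \<open>s\<close> and \<open>-t\<close> be the sequences with differences \<open>C\<close> and \<open>B\<close>. The conditions on the weights
  become a linear recurrence for \<open>s\<^sub>j t\<^sub>j\<close>, solved by
  \<open>((1 + jh)\<^sup>2 - r\<^sup>-\<^sup>2\<^sup>j) / (2h\<^sup>3)\<close>, together with a quadratic equation for \<open>s\<^sub>j t\<^sub>j\<^sub>-\<^sub>1\<close> whose
  discriminant is a perfect square. The equation defining \<open>r\<close> says that \<open>s\<^sub>n t\<^sub>n = 0\<close>, and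
  nonnegativity of the weights is Bernoulli's inequality \<open>1 + j (1 - r) \<le> r\<^sup>-\<^sup>j\<close>.
\<close>

section \<open>Gradients: tangent inequality for convex functions and quadratic upper bound for
  smooth ones\<close>

lemma GDERIV_grad:
  fixes f :: "'a::euclidean_space \<Rightarrow> real"
  assumes "f differentiable (at x)"
  shows "GDERIV f x :> grad f x"
proof -
  obtain D where D: "(f has_derivative D) (at x)"
    using assms by (auto simp: differentiable_def)
  then have lin: "linear D" by (simp add: has_derivative_linear)
  have "D v = v \<bullet> (\<Sum>b\<in>Basis. D b *\<^sub>R b)" for v
  proof -
    have "D v = D (\<Sum>b\<in>Basis. (v \<bullet> b) *\<^sub>R b)" by (simp add: euclidean_representation)
    also have "\<dots> = (\<Sum>b\<in>Basis. (v \<bullet> b) * D b)"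
      by (simp add: linear_sum[OF lin] linear_cmul[OF lin])
    finally show ?thesis by (simp add: inner_sum_right mult.commute)
  qed
  then have "D = (\<lambda>v. v \<bullet> (\<Sum>b\<in>Basis. D b *\<^sub>R b))" by blast
  with D have G: "GDERIV f x :> (\<Sum>b\<in>Basis. D b *\<^sub>R b)"
    unfolding gderiv_def by simp
  have unique: "a = b" if "GDERIV f x :> a" "GDERIV f x :> b" for a b
  proof -
    have "(\<lambda>v. v \<bullet> a) = (\<lambda>v. v \<bullet> b)"
      using that unfolding gderiv_def by (rule has_derivative_unique)
    then have "v \<bullet> a = v \<bullet> b" for v by (rule fun_cong)
    then show "a = b" using vector_eq_ldot[of a b] by blast
  qed
  show ?thesis
    unfolding grad_def by (rule theI[where P = "\<lambda>g. GDERIV f x :> g", OF G unique[OF _ G]])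
qed

lemma GDERIV_along_line:
  fixes f :: "'a::real_inner \<Rightarrow> real"
  assumes "GDERIV f (x + t *\<^sub>R d) :> g"
  shows "((\<lambda>t. f (x + t *\<^sub>R d)) has_real_derivative g \<bullet> d) (at t)"
proof -
  have "((\<lambda>t. x + t *\<^sub>R d) has_derivative (\<lambda>s. s *\<^sub>R d)) (at t)"
    by (auto intro!: derivative_eq_intros)
  then have "((\<lambda>t. f (x + t *\<^sub>R d)) has_derivative (\<lambda>s. (s *\<^sub>R d) \<bullet> g)) (at t)"
    using assms has_derivative_compose unfolding gderiv_def by blast
  moreover have "(\<lambda>s. (s *\<^sub>R d) \<bullet> g) = (\<lambda>s. (g \<bullet> d) * s)"
    by (auto simp: inner_commute)
  ultimately show ?thesis
    by (simp add: has_field_derivative_def)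
qed

lemma convex_on_grad_le:
  fixes f :: "'a::euclidean_space \<Rightarrow> real"
  assumes "convex_on UNIV f" and "f differentiable (at x)"
  shows "f x + grad f x \<bullet> (z - x) \<le> f z"
proof -
  let ?p = "\<lambda>t::real. f (x + t *\<^sub>R (z - x))"
  have "convex_on UNIV ?p"
  proof (rule convex_onI)
    fix t a b :: real
    assume "0 < t" "t < 1"
    have "x + ((1 - t) *\<^sub>R a + t *\<^sub>R b) *\<^sub>R (z - x)
        = (1 - t) *\<^sub>R (x + a *\<^sub>R (z - x)) + t *\<^sub>R (x + b *\<^sub>R (z - x))"
      by (simp add: algebra_simps)
    then show "?p ((1 - t) *\<^sub>R a + t *\<^sub>R b) \<le> (1 - t) * ?p a + t * ?p b"
      using convex_onD[OF assms(1), of t] \<open>0 < t\<close> \<open>t < 1\<close> by simp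
  qed simp
  moreover have "(?p has_real_derivative grad f x \<bullet> (z - x)) (at 0)"
    by (rule GDERIV_along_line) (simp add: GDERIV_grad[OF assms(2)])
  ultimately have "?p 1 - ?p 0 \<ge> (grad f x \<bullet> (z - x)) * (1 - 0)"
    by (intro convex_on_imp_above_tangent) auto
  then show ?thesis by simp
qed

lemma L_smooth_descent:
  fixes f :: "'a::euclidean_space \<Rightarrow> real"
  assumes "L_smooth L f"
  shows "f (x + d) \<le> f x + grad f x \<bullet> d + L / 2 * (norm d)\<^sup>2"
proof -
  have diff: "f differentiable (at z)" for z
    using assms by (simp add: L_smooth_def)
  have lip: "L-lipschitz_on UNIV (grad f)"
    using assms by (simp add: L_smooth_def)
  \<comment> \<open>Gap between \<open>f\<close> on the ray and the claimed quadratic bound; the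
    Lipschitz condition makes its derivative nonpositive.\<close>
  let ?q = "\<lambda>t::real. f (x + t *\<^sub>R d) - t * (grad f x \<bullet> d) - L / 2 * t\<^sup>2 * (norm d)\<^sup>2"
  have "?q 1 \<le> ?q 0"
  proof (rule DERIV_nonpos_imp_nonincreasing[where f = ?q])
    fix t :: real
    assume t: "0 \<le> t" "t \<le> 1"
    let ?D = "grad f (x + t *\<^sub>R d) \<bullet> d - grad f x \<bullet> d - L * t * (norm d)\<^sup>2"
    have "(?q has_real_derivative ?D) (at t)"
    proof (intro DERIV_diff)
      show "((\<lambda>t. f (x + t *\<^sub>R d)) has_real_derivative grad f (x + t *\<^sub>R d) \<bullet> d) (at t)"
        by (intro GDERIV_along_line GDERIV_grad diff)
      show "((\<lambda>t. t * (grad f x \<bullet> d)) has_real_derivative grad f x \<bullet> d) (at t)"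
        by (auto intro!: derivative_eq_intros)
      show "((\<lambda>t. L / 2 * t\<^sup>2 * (norm d)\<^sup>2) has_real_derivative L * t * (norm d)\<^sup>2) (at t)"
        by (auto intro!: derivative_eq_intros)
    qed
    moreover have "?D \<le> 0"
    proof -
      have "(grad f (x + t *\<^sub>R d) - grad f x) \<bullet> d \<le> norm (grad f (x + t *\<^sub>R d) - grad f x) * norm d"
        by (rule norm_cauchy_schwarz)
      also have "norm (grad f (x + t *\<^sub>R d) - grad f x) \<le> L * (t * norm d)"
        using lipschitz_onD[OF lip, of "x + t *\<^sub>R d" x] t by (simp add: dist_norm)
      finally show ?thesis
        by (simp add: inner_diff_left power2_eq_square mult_right_mono ac_simps)
    qed
    ultimately show "\<exists>D. (?q has_real_derivative D) (at t) \<and> D \<le> 0" by blast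
  qed simp
  then show ?thesis by simp
qed

section \<open>Values, subgradients and proximal map of \<open>prox_phi f\<close>\<close>

context
  fixes f :: "'a::euclidean_space \<Rightarrow> real"
  assumes conv: "convex_on UNIV f" and smooth: "L_smooth 1 f"
begin

text \<open>Equality case of Fenchel-Young: by the tangent inequality, \<open>x\<close> attains the
  supremum in the conjugate.\<close>

lemma prox_psi_grad:
  "prox_psi f (grad f x) = ereal (grad f x \<bullet> x - f x - 1/2 * (norm (grad f x))\<^sup>2)"
proof -
  have "fenchel_conjugate (\<lambda>x. ereal (f x)) (grad f x) = ereal (grad f x \<bullet> x - f x)"
    unfolding fenchel_conjugate_def
  proof (rule SUP_eqI)
    fix z
    have "f x + grad f x \<bullet> (z - x) \<le> f z"
      using conv smooth by (intro convex_on_grad_le) (auto simp: L_smooth_def)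
    then show "ereal (grad f x \<bullet> z) - ereal (f z) \<le> ereal (grad f x \<bullet> x - f x)"
      by (simp add: inner_diff_right)
  next
    fix w assume "\<And>z. z \<in> UNIV \<Longrightarrow> ereal (grad f x \<bullet> z) - ereal (f z) \<le> w"
    from this[of x] show "ereal (grad f x \<bullet> x - f x) \<le> w" by simp
  qed
  then show ?thesis by (simp add: prox_psi_def)
qed

text \<open>The term of the supremum indexed by \<open>grad f x\<close>: an affine minorant with
  that slope, which touches at \<open>x - grad f x\<close> by
  \<open>prox_phi_grad_step\<close>.\<close>

lemma prox_phi_ge:
  "ereal (f x + 1/2 * (norm (grad f x))\<^sup>2 + grad f x \<bullet> (y - x)) \<le> prox_phi f y"
proof -
  have "ereal (y \<bullet> grad f x) - prox_psi f (grad f x) \<le> prox_phi f y"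
    unfolding prox_phi_def fenchel_conjugate_def[of "prox_psi f" y]
    by (rule SUP_upper[OF UNIV_I, of "\<lambda>g. ereal (y \<bullet> g) - prox_psi f g"])
  moreover have "y \<bullet> grad f x - (grad f x \<bullet> x - f x - 1/2 * (norm (grad f x))\<^sup>2)
      = f x + 1/2 * (norm (grad f x))\<^sup>2 + grad f x \<bullet> (y - x)"
    by (simp add: inner_diff_right inner_commute[of y "grad f x"])
  ultimately show ?thesis
    by (simp only: prox_psi_grad ereal_minus(1))
qed

lemma prox_phi_grad_step:
  "prox_phi f (x - grad f x) = ereal (f x - 1/2 * (norm (grad f x))\<^sup>2)"
proof (rule antisym)
  show "prox_phi f (x - grad f x) \<le> ereal (f x - 1/2 * (norm (grad f x))\<^sup>2)"
    unfolding prox_phi_def fenchel_conjugate_def[of "prox_psi f"]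
  proof (rule SUP_least)
    fix g'
    \<comment> \<open>\<open>x + ?d\<close> maximises over \<open>z\<close> the lower bound on
      \<open>g' \<bullet> z - f z\<close> given by the descent lemma; all terms in \<open>g'\<close>
      then cancel.\<close>
    let ?g = "grad f x" and ?d = "g' - grad f x"
    have "ereal (g' \<bullet> (x + ?d) - f (x + ?d)) \<le> fenchel_conjugate (\<lambda>x. ereal (f x)) g'"
      unfolding fenchel_conjugate_def
      by (rule SUP_upper2[OF UNIV_I, of _ "\<lambda>z. ereal (g' \<bullet> z) - ereal (f z)" "x + ?d"]) simp
    then have "ereal (g' \<bullet> (x + ?d) - f (x + ?d) - 1/2 * (norm g')\<^sup>2) \<le> prox_psi f g'"
      unfolding prox_psi_def
      by (metis ereal_minus(1) ereal_minus_mono order_refl)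
    then have "ereal ((x - ?g) \<bullet> g') - prox_psi f g'
        \<le> ereal ((x - ?g) \<bullet> g') - ereal (g' \<bullet> (x + ?d) - f (x + ?d) - 1/2 * (norm g')\<^sup>2)"
      by (intro ereal_minus_mono) auto
    also have "\<dots> \<le> ereal (f x - 1/2 * (norm ?g)\<^sup>2)"
      using L_smooth_descent[OF smooth, of x ?d]
      by (simp add: power2_norm_eq_inner inner_simps add_divide_distrib diff_divide_distrib
          inner_commute[of g' ?g] inner_commute[of g' x] inner_commute[of x ?g])
    finally show "ereal ((x - ?g) \<bullet> g') - prox_psi f g' \<le> \<dots>" .
  qed
  show "ereal (f x - 1/2 * (norm (grad f x))\<^sup>2) \<le> prox_phi f (x - grad f x)"
    using prox_phi_ge[of x "x - grad f x"] by (simp add: power2_norm_eq_inner)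
qed

lemma prox_prox_phi: "prox (prox_phi f) x = x - grad f x"
proof -
  let ?F = "\<lambda>y. prox_phi f y + ereal (1/2 * (norm (y - x))\<^sup>2)"
  have min: "?F (x - grad f x) = ereal (f x)"
    by (simp add: prox_phi_grad_step)
  \<comment> \<open>Quadratic growth around \<open>x - grad f x\<close> gives uniqueness as well as
    minimality, which pins down the choice made by \<open>arg_min\<close>.\<close>
  have ge: "ereal (f x + 1/2 * (norm (y - (x - grad f x)))\<^sup>2) \<le> ?F y" for y
  proof -
    have "f x + 1/2 * (norm (y - (x - grad f x)))\<^sup>2
        = f x + 1/2 * (norm (grad f x))\<^sup>2 + grad f x \<bullet> (y - x) + 1/2 * (norm (y - x))\<^sup>2"
      by (simp add: power2_norm_eq_inner inner_simps add_divide_distrib diff_divide_distrib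
          inner_commute[of y "grad f x"]
          inner_commute[of x "grad f x"])
    then show ?thesis
      using add_right_mono[OF prox_phi_ge[of x y], of "ereal (1/2 * (norm (y - x))\<^sup>2)"]
      by (simp only: plus_ereal.simps(1))
  qed
  have "is_arg_min ?F (\<lambda>_. True) (x - grad f x)"
  proof -
    have "ereal (f x) \<le> ?F y" for y
      by (rule order_trans[OF _ ge]) simp
    then show ?thesis unfolding is_arg_min_def min by (simp add: not_less)
  qed
  then have "is_arg_min ?F (\<lambda>_. True) (prox (prox_phi f) x)"
    unfolding prox_def arg_min_def by (rule someI)
  then have "\<forall>y. ?F (prox (prox_phi f) x) \<le> ?F y"
    by (simp add: is_arg_min_def not_less)
  then have "?F (prox (prox_phi f) x) \<le> ereal (f x)"
    unfolding min[symmetric] by (rule spec)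
  with ge[of "prox (prox_phi f) x"]
  have "f x + 1/2 * (norm (prox (prox_phi f) x - (x - grad f x)))\<^sup>2 \<le> f x"
    by (metis ereal_less_eq(3) order_trans)
  then show ?thesis by simp
qed

text \<open>Both values of \<open>prox_phi f\<close> are finite by
  \<open>prox_phi_grad_step\<close>, so the minorant becomes an inequality between reals; the
  weights below combine inequalities of this form.\<close>

lemma prox_phi_subgradient:
  "f z - 1/2 * (norm (grad f z))\<^sup>2 + grad f z \<bullet> ((x - grad f x) - (z - grad f z))
    \<le> f x - 1/2 * (norm (grad f x))\<^sup>2"
  using prox_phi_ge[of z "x - grad f x"]
  unfolding prox_phi_grad_step
  by (simp add: inner_diff_right power2_norm_eq_inner)

text \<open>Otherwise a unit gradient step would strictly decrease \<open>f\<close>.\<close>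

lemma grad_eq_0_at_min:
  assumes "is_arg_min f (\<lambda>_. True) x"
  shows "grad f x = 0"
proof -
  have "f x \<le> f (x - grad f x)"
    using assms by (auto simp: is_arg_min_def not_less)
  also have "\<dots> \<le> f x - 1/2 * (norm (grad f x))\<^sup>2"
    using L_smooth_descent[OF smooth, of x "- grad f x"] by (simp add: power2_norm_eq_inner)
  finally show ?thesis by simp
qed

end

section \<open>Weighted combination of the subgradient inequalities\<close>

lemma sum_by_parts:
  fixes C :: "nat \<Rightarrow> real" and y :: "nat \<Rightarrow> 'a::real_vector"
  assumes "C 0 = 0"
  shows "(\<Sum>i<k. (C (Suc i) - C i) *\<^sub>R (y i - y k)) = (\<Sum>i<k. C (Suc i) *\<^sub>R (y i - y (Suc i)))"
proof (induction k)
  case (Suc k)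
  have "(\<Sum>i<k. C (Suc i) - C i) = C k"
    using assms by (simp add: sum_lessThan_telescope)
  then have "(\<Sum>i<k. (C (Suc i) - C i) *\<^sub>R (y k - y (Suc k))) = C k *\<^sub>R (y k - y (Suc k))"
    by (simp flip: scaleR_sum_left)
  moreover have "(\<Sum>i<k. (C (Suc i) - C i) *\<^sub>R (y i - y (Suc k)))
      = (\<Sum>i<k. (C (Suc i) - C i) *\<^sub>R (y i - y k)) + (\<Sum>i<k. (C (Suc i) - C i) *\<^sub>R (y k - y (Suc k)))"
    by (simp add: sum.distrib[symmetric] scaleR_add_right[symmetric])
  ultimately show ?case
    using Suc.IH by (simp add: algebra_simps)
qed simp

text \<open>At \<open>k = 0\<close> the truncated index makes \<open>B (k - 1)\<close> equal to \<open>B 0\<close>; this is harmless because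
  its factors \<open>C 0\<close> and the empty sum vanish.\<close>

lemma separable_weights_le:
  fixes g y :: "nat \<Rightarrow> 'a::real_inner" and p C B e :: "nat \<Rightarrow> real"
  assumes step: "\<And>k. k < n \<Longrightarrow> y k - y (Suc k) = r *\<^sub>R g k + g (Suc k)"
    and subgrad: "\<And>i j. i \<le> n \<Longrightarrow> j \<le> n \<Longrightarrow> p j + g j \<bullet> (y i - y j) \<le> p i"
    and C0: "C 0 = 0" and Bn: "B n = 0" and en: "e n = 0"
    and C_mono: "\<And>k. k < n \<Longrightarrow> C k \<le> C (Suc k)"
    and B_mono: "\<And>k. k < n \<Longrightarrow> B (Suc k) \<le> B k"
    and e_step: "\<And>k. k < n \<Longrightarrow> e k - e (Suc k) = B k + r * B (Suc k)"
    and r: "0 \<le> r"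
    and flow: "\<And>k. k < n \<Longrightarrow>
      B (k - 1) * (\<Sum>j<k. C j + r * C (Suc j)) - C k * (B (k - 1) + r * B k)
        + e k * (C (Suc k) - C k) - B k * (\<Sum>j<Suc k. C j + r * C (Suc j)) = 1"
    and diag: "\<And>k. k < n \<Longrightarrow> C k * (B (k - 1) + r * B k) = r * B k * (C k + r * C (Suc k)) - D"
  shows "0 \<le> (\<Sum>i<n. p i + D * (norm (g i))\<^sup>2)
    + (B (n - 1) * (\<Sum>j<n. C j + r * C (Suc j)) - C n * B (n - 1)) * p n
    - C n * B (n - 1) * (norm (g n))\<^sup>2"
proof -
  define A where "A j = C j + r * C (Suc j)" for j
  define a where "a k = (\<Sum>j<k. A j)" for k
  define E where "E k = B (k - 1) + r * B k" for k
  define G where "G k = (\<Sum>j<k. A j *\<^sub>R g j)" for k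
  define Y where "Y k = (\<Sum>i<k. (C (Suc i) - C i) * p i)" for k
  \<comment> \<open>Slacks between \<open>k\<close> and earlier indices: \<open>low\<close> takes
    the subgradients at \<open>j < k\<close>, \<open>up\<close> the one at \<open>k\<close>. The
    claim is \<open>0 \<le> S n\<close> with \<open>S n\<close> expanded.\<close>
  define low where "low k = (\<Sum>j<k. A j * (p k - p j - g j \<bullet> (y k - y j)))" for k
  define up where "up k = (\<Sum>i<k. (C (Suc i) - C i) * (p i - p k - g k \<bullet> (y i - y k)))" for k
  define S where "S k = (\<Sum>i<k. (B i - B (Suc i)) * low (Suc i) + E (Suc i) * up (Suc i))" for k
  have C_nonneg: "0 \<le> C k" if "k \<le> n" for k
    using that
  proof (induction k)
    case (Suc k) then show ?case using C_mono[of k] by simp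
  qed (simp add: C0)
  have B_nonneg: "0 \<le> B k" if "k \<le> n" for k
    using that
  proof (induction k rule: inc_induct)
    case (step k) then show ?case using B_mono[of k] by simp
  qed (simp add: Bn)
  have S_nonneg: "0 \<le> S n"
    unfolding S_def
  proof (intro sum_nonneg add_nonneg_nonneg mult_nonneg_nonneg)
    fix i assume "i \<in> {..<n}"
    then have i: "i < n" by simp
    show "0 \<le> B i - B (Suc i)" using B_mono[OF i] by simp
    show "0 \<le> E (Suc i)"
      using B_nonneg[of i] B_nonneg[of "Suc i"] i r by (simp add: E_def)
    show "0 \<le> low (Suc i)"
      unfolding low_def
    proof (intro sum_nonneg mult_nonneg_nonneg)
      fix j assume "j \<in> {..<Suc i}"
      then have j: "j \<le> i" by simp
      show "0 \<le> A j"
        using C_nonneg[of j] C_nonneg[of "Suc j"] i j r by (simp add: A_def)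
      show "0 \<le> p (Suc i) - p j - g j \<bullet> (y (Suc i) - y j)"
        using subgrad[of "Suc i" j] i j by simp
    qed
    show "0 \<le> up (Suc i)"
      unfolding up_def
    proof (intro sum_nonneg mult_nonneg_nonneg)
      fix j assume "j \<in> {..<Suc i}"
      then have j: "j \<le> i" by simp
      show "0 \<le> C (Suc j) - C j" using C_mono[of j] i j by simp
      show "0 \<le> p j - p (Suc i) - g (Suc i) \<bullet> (y j - y (Suc i))"
        using subgrad[of j "Suc i"] i j by simp
    qed
  qed
  have low_Suc: "low (Suc k) = low k + a (Suc k) * (p (Suc k) - p k)
      + G (Suc k) \<bullet> (r *\<^sub>R g k + g (Suc k))" if "k < n" for k
  proof -
    have "low (Suc k) = (\<Sum>j<Suc k. A j * (p k - p j - g j \<bullet> (y k - y j))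
        + (A j * (p (Suc k) - p k) + (A j *\<^sub>R g j) \<bullet> (y k - y (Suc k))))"
      unfolding low_def by (intro sum.cong) (auto simp: algebra_simps inner_diff_right)
    also have "\<dots> = low k + (a (Suc k) * (p (Suc k) - p k) + G (Suc k) \<bullet> (y k - y (Suc k)))"
      unfolding sum.distrib low_def a_def G_def sum_distrib_right inner_sum_left by simp
    finally show ?thesis by (simp add: step[OF that])
  qed
  have up_eq: "up k = Y k - C k * p k - g k \<bullet> G k - C k * (norm (g k))\<^sup>2" if "k \<le> n" for k
  proof -
    have C_sum: "(\<Sum>i<k. C (Suc i) - C i) = C k"
      by (simp add: sum_lessThan_telescope C0)
    \<comment> \<open>After summation by parts the step rule yields \<open>C (Suc i)\<close> times
      \<open>r *\<^sub>R g i + g (Suc i)\<close>; collecting each \<open>g j\<close> gives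
      \<open>C j + r * C (Suc j)\<close>, whence the form of \<open>A\<close>.\<close>
    have "(\<Sum>i<k. (C (Suc i) - C i) *\<^sub>R (y i - y k)) = G k + C k *\<^sub>R g k"
      unfolding sum_by_parts[where C = C, OF C0]
      using that
    proof (induction k)
      case (Suc k)
      then show ?case by (simp add: step G_def A_def algebra_simps)
    qed (simp add: G_def C0)
    then have "g k \<bullet> (\<Sum>i<k. (C (Suc i) - C i) *\<^sub>R (y i - y k)) = g k \<bullet> G k + C k * (norm (g k))\<^sup>2"
      by (simp add: inner_add_right power2_norm_eq_inner)
    moreover have "up k = Y k - (\<Sum>i<k. C (Suc i) - C i) * p k
        - g k \<bullet> (\<Sum>i<k. (C (Suc i) - C i) *\<^sub>R (y i - y k))"
      unfolding up_def Y_def sum_distrib_right inner_sum_right sum_subtractf[symmetric]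
      by (intro sum.cong) (auto simp: algebra_simps)
    ultimately show ?thesis by (simp add: C_sum)
  qed
  \<comment> \<open>summation by parts: every cross term \<open>g i \<bullet> g j\<close> cancels, apart from boundary terms at \<open>k\<close>\<close>
  have "S k = (\<Sum>i<k. p i + D * (norm (g i))\<^sup>2) - B k * low k - e k * Y k - r * B k * (g k \<bullet> G k)
      + (B (k - 1) * a k - C k * E k) * p k - C k * E k * (norm (g k))\<^sup>2" if "k \<le> n" for k
    using that
  proof (induction k)
    case 0
    then show ?case by (simp add: S_def low_def Y_def G_def a_def C0)
  next
    case (Suc k)
    then have k: "k < n" by simp
    have E_Suc: "E (Suc k) = B k + r * B (Suc k)" by (simp add: E_def)
    \<comment> \<open>\<open>e k\<close> is the sum of \<open>E i\<close> over
      \<open>k < i \<le> n\<close>, so \<open>e k * (C (Suc k) - C k)\<close> is the total weight of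
      \<open>p k\<close> in the later \<open>up\<close> terms.\<close>
    have e: "e k = e (Suc k) + E (Suc k)" using e_step[OF k] E_Suc by simp
    have Y: "Y (Suc k) = Y k + (C (Suc k) - C k) * p k" by (simp add: Y_def)
    have G: "G (Suc k) = G k + A k *\<^sub>R g k" by (simp add: G_def)
    \<comment> \<open>\<open>flow\<close> leaves \<open>p k\<close> with coefficient 1, the rest
      cancelling against \<open>low\<close> and \<open>Y\<close>; \<open>di\<close> likewise leaves
      the squared norm of \<open>g k\<close> with coefficient \<open>D\<close>.\<close>
    have fl: "B (k - 1) * a k - C k * E k = 1 - e k * (C (Suc k) - C k) + B k * a (Suc k)"
      using flow[OF k] unfolding a_def A_def E_def by simp
    have di: "C k * E k = r * B k * A k - D"
      using diag[OF k] unfolding A_def E_def by simp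
    have IH: "S k = (\<Sum>i<k. p i + D * (norm (g i))\<^sup>2) - B k * low k - e k * Y k
      - r * B k * (g k \<bullet> G k) + (1 - e k * (C (Suc k) - C k) + B k * a (Suc k)) * p k
      - (r * B k * A k - D) * (norm (g k))\<^sup>2"
      unfolding fl[symmetric] di[symmetric] using Suc by simp
    have Gr: "G (Suc k) \<bullet> (r *\<^sub>R g k + g (Suc k))
        = r * (g k \<bullet> G k) + r * A k * (norm (g k))\<^sup>2 + g (Suc k) \<bullet> G (Suc k)"
      unfolding G by (simp add: inner_simps power2_norm_eq_inner inner_commute algebra_simps)
    have "S (Suc k) = S k + (B k - B (Suc k)) * low (Suc k)
        + E (Suc k) * (Y (Suc k) - C (Suc k) * p (Suc k) - g (Suc k) \<bullet> G (Suc k)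
            - C (Suc k) * (norm (g (Suc k)))\<^sup>2)"
      using Suc.prems by (simp add: S_def up_eq)
    moreover have "B k * low (Suc k) = B k * low k + B k * a (Suc k) * (p (Suc k) - p k)
        + B k * (r * (g k \<bullet> G k) + r * A k * (norm (g k))\<^sup>2 + g (Suc k) \<bullet> G (Suc k))"
      unfolding low_Suc[OF k] Gr by (simp add: algebra_simps)
    moreover have "e k * Y k = (e (Suc k) + E (Suc k)) * Y (Suc k) - e k * (C (Suc k) - C k) * p k"
      unfolding Y e by (simp add: algebra_simps)
    ultimately show ?case
      unfolding IH E_Suc by (simp add: algebra_simps)
  qed
  from this[of n] S_nonneg show ?thesis
    by (simp add: Bn en E_def a_def A_def)
qed

section \<open>Construction of the weights\<close>

lemma power_less_chord:
  fixes q :: real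
  assumes "1 < q" and "q ^ n = 1 + real n * h" and "1 \<le> i" and "i < n"
  shows "q ^ i < 1 + real i * h"
proof -
  \<comment> \<open>\<open>(q ^ j - 1) / j\<close> is strictly increasing in \<open>j\<close>, and equals \<open>h\<close> at \<open>j = n\<close>\<close>
  have F: "real j * q ^ Suc j - real (Suc j) * q ^ j + 1 > 0" if "1 \<le> j" for j
    using that
  proof (induction j rule: dec_induct)
    case base
    have "0 < (q - 1)\<^sup>2" using assms(1) by simp
    then show ?case by (simp add: power2_eq_square algebra_simps)
  next
    case (step j)
    have "0 < real (Suc j) * q ^ j * (q - 1)\<^sup>2" using assms(1) by simp
    also have "\<dots> = (real (Suc j) * q ^ Suc (Suc j) - real (Suc (Suc j)) * q ^ Suc j + 1)
        - (real j * q ^ Suc j - real (Suc j) * q ^ j + 1)"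
      by (simp add: power2_eq_square algebra_simps)
    finally show ?case using step.IH by simp
  qed
  \<comment> \<open>Downward induction from \<open>n\<close>, where equality holds; hence the bound
    is strict only below \<open>n\<close>.\<close>
  have "q ^ j \<le> 1 + real j * h \<and> (j < n \<longrightarrow> q ^ j < 1 + real j * h)" if "i \<le> j" "j \<le> n" for j
    using that(2,1)
  proof (induction j rule: inc_induct)
    case base
    then show ?case using assms(2) by simp
  next
    case (step j)
    then have "q ^ Suc j \<le> 1 + real (Suc j) * h" by simp
    then have "real j * (q ^ Suc j - 1) \<le> real j * (real (Suc j) * h)"
      by (intro mult_left_mono) auto
    moreover have "real (Suc j) * (q ^ j - 1) < real j * (q ^ Suc j - 1)"
      using F[of j] step assms(3) by (simp add: algebra_simps)
    ultimately have "real (Suc j) * (q ^ j - 1) < real (Suc j) * (real j * h)"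
      unfolding mult.left_commute[of "real j" "real (Suc j)" h] by linarith
    then have "q ^ j - 1 < real j * h"
      by (rule mult_left_less_imp_less) simp
    then show ?case by simp
  qed
  then show ?thesis using assms(4) by auto
qed

text \<open>Supplies the data for \<open>separable_weights_le\<close> with
  \<open>D = (1 - r) / 2\<close>; the last two properties evaluate the coefficients left at index
  \<open>n\<close>.\<close>

lemma critical_weights:
  fixes r h :: real
  assumes n: "n \<ge> 1" and r: "0 < r" "r < 1" and root: "r ^ n * (1 + real n * h) = 1"
    and h: "h = 1 + r"
  obtains C B e :: "nat \<Rightarrow> real" where
    "C 0 = 0" "B n = 0" "e n = 0"
    "\<And>k. k < n \<Longrightarrow> C k \<le> C (Suc k)"
    "\<And>k. k < n \<Longrightarrow> B (Suc k) \<le> B k"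
    "\<And>k. k < n \<Longrightarrow> e k - e (Suc k) = B k + r * B (Suc k)"
    "\<And>k. k < n \<Longrightarrow>
      B (k - 1) * (\<Sum>j<k. C j + r * C (Suc j)) - C k * (B (k - 1) + r * B k)
        + e k * (C (Suc k) - C k) - B k * (\<Sum>j<Suc k. C j + r * C (Suc j)) = 1"
    "\<And>k. k < n \<Longrightarrow> C k * (B (k - 1) + r * B k) = r * B k * (C k + r * C (Suc k)) - (1 - r) / 2"
    "B (n - 1) * (\<Sum>j<n. C j + r * C (Suc j)) - C n * B (n - 1) = - real n"
    "C n * B (n - 1) = real n * (1 + real n * h / 2)"
proof -
  define q where "q = 1 / r"
  define K where "K = 1 / (2 * h ^ 3)"
  define m where "m j = 1 + real j * h" for j
  define u where "u j = q ^ j" for j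
  \<comment> \<open>This product satisfies
    \<open>(m j + u j) * c j = (m j - u j) * c (Suc j)\<close> for \<open>1 \<le> j < n\<close>, so
    \<open>c\<close> drops out of \<open>s j * t j\<close> and of the mixed products of neighbouring
    terms.\<close>
  define c where "c j = (\<Prod>i\<in>{1..<j}. (m i + u i) / (m i - u i))" for j
  define s where "s j = (if j = 0 then 0 else (m j + u j) * c j)" for j
  \<comment> \<open>The value at \<open>n\<close> is set apart: \<open>m n - u n = 0\<close>, so
    \<open>c (Suc n)\<close> contains a division by zero.\<close>
  define t where "t j = (if j < n then K * (m j + u j) / c (Suc j) else 0)" for j
  \<comment> \<open>Truncated subtraction makes \<open>C 0 = 0\<close>.\<close>
  define C where "C j = s j - s (j - 1)" for j
  define B where "B j = t j - t (Suc j)" for j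
  \<comment> \<open>Closed form of the tail sums of \<open>B k + r * B (Suc k)\<close>, using
    \<open>h = 1 + r\<close>.\<close>
  define e where "e j = h * t j - r * B j" for j
  have q: "1 < q" "r * q = 1" using r by (simp_all add: q_def)
  have hhq: "h\<^sup>2 * q = q + 2 + r"
  proof -
    have "h\<^sup>2 * q = q + 2 * (r * q) + r * (r * q)"
      by (simp add: h power2_eq_square algebra_simps)
    then show ?thesis unfolding q(2) by simp
  qed
  have h_pos: "0 < h" and K_pos: "0 < K" using r by (simp_all add: h K_def)
  have hq: "1 + q = q * h" using q(2) by (simp add: h algebra_simps)
  have m_Suc: "m (Suc j) = m j + h" and u_Suc: "u (Suc j) = q * u j" for j
    by (simp_all add: m_def u_def algebra_simps)
  have m_pos: "0 < m j" and u_pos: "0 < u j" for j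
    using h_pos q(1) by (simp_all add: m_def u_def add_pos_nonneg)
  \<comment> \<open>The equation for \<open>r\<close> says that \<open>u\<close> meets the line
    \<open>m\<close> at \<open>n\<close>, as it does at 0. Strictly between them \<open>u\<close>
    lies below, so the factors of \<open>c\<close> are positive.\<close>
  have un: "u n = m n"
    using root r by (simp add: u_def m_def q_def power_divide field_simps)
  have lt: "u i < m i" if "1 \<le> i" "i < n" for i
    unfolding u_def m_def using power_less_chord[OF q(1) _ that] un by (simp add: u_def m_def)
  have c_pos: "0 < c j" if "j \<le> n" for j
    unfolding c_def using that m_pos u_pos lt by (intro prod_pos) (auto intro!: divide_pos_pos add_pos_pos)
  have c_Suc: "(m j + u j) * c j = (m j - u j) * c (Suc j)" if "1 \<le> j" "j < n" for j
    using lt[OF that] that(1) by (simp add: c_def prod.atLeastLessThan_Suc)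
  have t_alt: "t j = K * (m j - u j) / c j" if "1 \<le> j" "j \<le> n" for j
  proof (cases "j < n")
    case True
    have "(m j + u j) / c (Suc j) = (m j - u j) / c j"
      using c_Suc[OF that(1) True] c_pos[of j] c_pos[of "Suc j"] True by (simp add: field_simps)
    then show ?thesis using True by (simp add: t_def flip: times_divide_eq_right)
  next
    case False
    then have "j = n" using that by simp
    then show ?thesis by (simp add: t_def un)
  qed
  have s_Suc: "s (Suc j) = (m (Suc j) + u (Suc j)) * c (Suc j)" for j
    by (simp add: s_def)
  have s_alt: "s j = (m j - u j) * c (Suc j)" if "j < n" for j
    using c_Suc[of j] that by (cases j) (simp_all add: s_def m_def u_def)
  have z: "s (Suc j) * t j = K * ((m (Suc j) + u (Suc j)) * (m j + u j))" if "j < n" for j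
    using that c_pos[of "Suc j"] by (simp add: s_Suc t_def)
  have z': "s j * t (Suc j) = K * ((m j - u j) * (m (Suc j) - u (Suc j)))" if "j < n" for j
    using that c_pos[of "Suc j"] by (simp add: s_alt t_alt)
  have P: "s j * t j = K * (m j + u j) * (m j - u j)" if "j \<le> n" for j
  proof (cases j)
    case 0
    then show ?thesis by (simp add: s_def m_def u_def)
  next
    case (Suc i)
    then show ?thesis using that c_pos[of j] by (simp add: s_Suc t_alt)
  qed
  have s_pos: "0 < s j" if "1 \<le> j" "j \<le> n" for j
    using that c_pos[of j] m_pos[of j] u_pos[of j] by (simp add: s_def)
  have t_pos: "0 < t j" if "j < n" for j
    using that c_pos[of "Suc j"] m_pos[of j] u_pos[of j] K_pos by (simp add: t_def)
  \<comment> \<open>In the diagonal condition the terms \<open>C k * B k\<close> cancel, leaving a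
    linear recurrence for \<open>C k * B (k - 1)\<close>; this is its solution starting from
    0.\<close>
  have CB: "C k * B (k - 1) = ((u k)\<^sup>2 - 1) / (2 * h)" if "k \<le> n" for k
  proof (cases k)
    case 0
    then show ?thesis by (simp add: C_def u_def)
  next
    case (Suc j)
    then have j: "j < n" using that by simp
    have "C (Suc j) * B j = s (Suc j) * t j + s j * t (Suc j) - s (Suc j) * t (Suc j) - s j * t j"
      by (simp add: C_def B_def algebra_simps)
    also have "\<dots> = K * ((u j * (1 + q))\<^sup>2 - h\<^sup>2)"
      using j by (simp add: z z' P m_Suc u_Suc) (simp add: power2_eq_square algebra_simps)
    also have "\<dots> = K * h\<^sup>2 * ((u (Suc j))\<^sup>2 - 1)"
      unfolding hq u_Suc by (simp add: power2_eq_square algebra_simps)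
    also have "\<dots> = ((u (Suc j))\<^sup>2 - 1) / (2 * h)"
      using h_pos by (simp add: K_def power2_eq_square power3_eq_cube)
    finally show ?thesis using Suc by simp
  qed
  have a: "(\<Sum>j<k. C j + r * C (Suc j)) = h * s k - C k" for k
  proof (induction k)
    case 0
    then show ?case by (simp add: C_def s_def)
  next
    case (Suc k)
    then show ?case by (simp add: C_def h algebra_simps)
  qed
  \<comment> \<open>Second differences of \<open>s\<close> and \<open>t\<close>, multiplied by
    \<open>t k\<close> and \<open>s k\<close> so that \<open>z\<close>, \<open>z'\<close> and
    \<open>P\<close> apply. Their sum yields \<open>core\<close>, their signs the monotonicity of
    \<open>C\<close> and \<open>B\<close>.\<close>
  have tC: "t k * (C (Suc k) - C k) = K * u k * (u k * h\<^sup>2 * q + (m k * (q - r) + 2 * h))"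
    and sB: "s k * (B (k - 1) - B k) = K * u k * (u k * h\<^sup>2 * q - (m k * (q - r) + 2 * h))"
    if k: "1 \<le> k" "k < n" for k
  proof -
    obtain i where i: "k = Suc i" using k by (cases k) auto
    have "i < n" using i k by simp
    have rq: "u i = r * u k" "m i = m k - h" using q(2) by (simp_all add: i m_Suc u_Suc)
    have st: "s k * t i = K * ((m k + u k) * (m k - h + r * u k))"
      "s i * t k = K * ((m k - h - r * u k) * (m k - u k))"
      "s (Suc k) * t k = K * ((m k + h + q * u k) * (m k + u k))"
      "s k * t (Suc k) = K * ((m k - u k) * (m k + h - q * u k))"
      "s k * t k = K * (m k + u k) * (m k - u k)"
      using z[OF \<open>i < n\<close>] z'[OF \<open>i < n\<close>] z[OF k(2)] z'[OF k(2)] P[of k] k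
      by (simp_all only: i[symmetric] rq m_Suc u_Suc less_imp_le)
    have "t k * (C (Suc k) - C k) = s (Suc k) * t k - 2 * (s k * t k) + s i * t k"
      by (simp add: C_def i algebra_simps)
    also have "\<dots> = K * u k * (u k * (h\<^sup>2 * q) + (m k * (q - r) + 2 * h))"
      unfolding hhq st by (simp add: algebra_simps)
    finally show "t k * (C (Suc k) - C k) = K * u k * (u k * h\<^sup>2 * q + (m k * (q - r) + 2 * h))"
      by (simp add: mult.assoc)
    have "s k * (B (k - 1) - B k) = s k * t i - 2 * (s k * t k) + s k * t (Suc k)"
      by (simp add: B_def i algebra_simps)
    also have "\<dots> = K * u k * (u k * (h\<^sup>2 * q) - (m k * (q - r) + 2 * h))"
      unfolding hhq st by (simp add: algebra_simps)
    finally show "s k * (B (k - 1) - B k) = K * u k * (u k * h\<^sup>2 * q - (m k * (q - r) + 2 * h))"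
      by (simp add: mult.assoc)
  qed
  \<comment> \<open>The left side of the flow condition is \<open>h\<close> times this quantity,
    minus \<open>2 * (C k * B (k - 1))\<close> and \<open>2 * r * (C (Suc k) * B k)\<close>, both
    known from \<open>CB\<close>.\<close>
  have core: "s k * (B (k - 1) - B k) + t k * (C (Suc k) - C k) = (u k)\<^sup>2 * q / h" if "k < n" for k
  proof (cases "k = 0")
    case True
    have "s (Suc 0) * t 0 = 2 * K * (1 + h + q)"
      using z[of 0] True that by (simp add: m_def u_def)
    also have "1 + h + q = h\<^sup>2 * q"
      unfolding hhq by (simp add: h)
    finally have "s (Suc 0) * t 0 = q / h"
      using h_pos by (simp add: K_def power2_eq_square power3_eq_cube)
    then show ?thesis using True by (simp add: C_def s_def u_def mult.commute)
  next
    case False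
    then have "s k * (B (k - 1) - B k) + t k * (C (Suc k) - C k) = 2 * K * h\<^sup>2 * ((u k)\<^sup>2 * q)"
      using sB[of k] tC[of k] that by (simp add: power2_eq_square algebra_simps)
    then show ?thesis
      using h_pos by (simp add: K_def power2_eq_square power3_eq_cube)
  qed
  have C_mono: "C k \<le> C (Suc k)" if k: "k < n" for k
  proof (cases "k = 0")
    case True
    then show ?thesis using s_pos[of 1] n by (simp add: C_def s_def)
  next
    case False
    then have "0 \<le> t k * (C (Suc k) - C k)"
      using tC[of k] k K_pos u_pos[of k] m_pos[of k] h_pos q r
      by (simp add: add_nonneg_nonneg)
    then show ?thesis using t_pos[OF k] by (simp add: zero_le_mult_iff)
  qed
  have B_mono: "B (Suc k) \<le> B k" if k: "k < n" for k
  \<comment> \<open>\<open>sB\<close> covers only indices below \<open>n\<close>; at the end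
    \<open>B n = 0\<close> and \<open>B (n - 1) = t (n - 1) > 0\<close>.\<close>
  proof (cases "Suc k = n")
    case True
    then have "t (Suc k) = 0" "t (Suc (Suc k)) = 0" by (auto simp: t_def)
    then show ?thesis using t_pos[OF k] by (simp add: B_def)
  next
    case False
    define j where "j = Suc k"
    have j: "1 \<le> j" "j < n" using False k by (auto simp: j_def)
    \<comment> \<open>The right side of \<open>sB\<close> contains the factor
      \<open>u j - 1 - real j * (1 - r)\<close>; Bernoulli with \<open>1 - r \<le> q - 1\<close>
      makes it nonnegative.\<close>
    have "1 + real j * (q - 1) \<le> u j"
      using Bernoulli_inequality[of "q - 1" j] q(1) by (simp add: u_def)
    moreover have "1 + real j * (1 - r) \<le> 1 + real j * (q - 1)"
    proof -
      have "0 \<le> (q - 1) * (1 - r)" using q(1) r by simp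
      then have "1 - r \<le> q - 1" using q(2) by (simp add: algebra_simps)
      then show ?thesis by (simp add: mult_left_mono)
    qed
    ultimately have "0 \<le> u j - 1 - real j * (1 - r)" by simp
    then have "0 \<le> K * u j * (q * h\<^sup>2 * (u j - 1 - real j * (1 - r)))"
      using K_pos u_pos[of j] q(1) by (intro mult_nonneg_nonneg) auto
    also have "q * h\<^sup>2 * (u j - 1 - real j * (1 - r)) = u j * h\<^sup>2 * q - (m j * (q - r) + 2 * h)"
    proof -
      have "q * h * (1 - r) = q - r * (r * q)" "q * h * (2 * r) = 2 * h * (r * q)"
        by (simp_all add: h algebra_simps)
      then have "q - r = q * h * (1 - r)" "2 * h = q * h * (2 * r)"
        unfolding q(2) by simp_all
      then have "m j * (q - r) + 2 * h = m j * (q * h * (1 - r)) + q * h * (2 * r)"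
        by (simp only:)
      also have "\<dots> = q * h * (m j * (1 - r) + 2 * r)" by (simp add: algebra_simps)
      also have "m j * (1 - r) + 2 * r = h * (1 + real j * (1 - r))"
        by (simp add: m_def h algebra_simps)
      finally show ?thesis by (simp add: power2_eq_square algebra_simps)
    qed
    finally have "0 \<le> s j * (B (j - 1) - B j)" unfolding sB[OF j] .
    then show ?thesis using s_pos[of j] j by (simp add: zero_le_mult_iff j_def)
  qed
  show thesis
  proof (rule that[of C B e])
    show "C 0 = 0" by (simp add: C_def)
    show Bn: "B n = 0" by (simp add: B_def t_def)
    show "e n = 0" using Bn by (simp add: e_def t_def)
    show "C k \<le> C (Suc k)" if "k < n" for k using that by (rule C_mono)
    show "B (Suc k) \<le> B k" if "k < n" for k using that by (rule B_mono)
    show "e k - e (Suc k) = B k + r * B (Suc k)" for k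
      by (simp add: e_def B_def h algebra_simps)
    show "B (k - 1) * (\<Sum>j<k. C j + r * C (Suc j)) - C k * (B (k - 1) + r * B k)
        + e k * (C (Suc k) - C k) - B k * (\<Sum>j<Suc k. C j + r * C (Suc j)) = 1"
      if k: "k < n" for k
    proof -
      have sk: "s (Suc k) = s k + C (Suc k)" by (simp add: C_def)
      have X: "C (Suc k) * B k = ((q * u k)\<^sup>2 - 1) / (2 * h)"
        using CB[of "Suc k"] k by (simp add: u_Suc)
      have "B (k - 1) * (h * s k - C k) - C k * (B (k - 1) + r * B k)
          + e k * (C (Suc k) - C k) - B k * (h * s (Suc k) - C (Suc k))
        = h * (s k * (B (k - 1) - B k) + t k * (C (Suc k) - C k))
          - 2 * (C k * B (k - 1)) - 2 * r * (C (Suc k) * B k)"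
        unfolding sk e_def by (simp add: h algebra_simps)
      also have "\<dots> = h * ((u k)\<^sup>2 * q / h) - 2 * (((u k)\<^sup>2 - 1) / (2 * h))
          - 2 * r * (((q * u k)\<^sup>2 - 1) / (2 * h))"
        unfolding core[OF k] X CB[OF less_imp_le[OF k]] ..
      also have "\<dots> = (h * (u k)\<^sup>2 * q - ((u k)\<^sup>2 - 1) - r * ((q * u k)\<^sup>2 - 1)) / h"
        using h_pos by (simp add: field_simps)
      also have "h * (u k)\<^sup>2 * q - ((u k)\<^sup>2 - 1) - r * ((q * u k)\<^sup>2 - 1)
          = (u k)\<^sup>2 * (q * h - 1 - (r * q) * q) + (1 + r)"
        by (simp add: power2_eq_square algebra_simps)
      also have "\<dots> = h" unfolding q(2) hq[symmetric] by (simp add: h)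
      finally show ?thesis using h_pos by (simp add: a del: sum.lessThan_Suc)
    qed
    show "C k * (B (k - 1) + r * B k) = r * B k * (C k + r * C (Suc k)) - (1 - r) / 2"
      if k: "k < n" for k
    proof -
      have "C k * B (k - 1) = ((u k)\<^sup>2 - 1) / (2 * h)" using CB k by simp
      also have "\<dots> = r\<^sup>2 * (((q * u k)\<^sup>2 - 1) / (2 * h)) - (1 - r) / 2"
      proof -
        have "r\<^sup>2 * ((q * u k)\<^sup>2 - 1) = (r * q)\<^sup>2 * (u k)\<^sup>2 - r\<^sup>2"
          by (simp add: power2_eq_square algebra_simps)
        also have "\<dots> = (u k)\<^sup>2 - 1 + (1 - r) * h" unfolding q(2) by (simp add: h power2_eq_square algebra_simps)
        finally have "r\<^sup>2 * (((q * u k)\<^sup>2 - 1) / (2 * h)) = ((u k)\<^sup>2 - 1 + (1 - r) * h) / (2 * h)"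
          by (simp only: times_divide_eq_right)
        then show ?thesis using h_pos by (simp add: add_divide_distrib)
      qed
      also have "((q * u k)\<^sup>2 - 1) / (2 * h) = C (Suc k) * B k"
        using CB[of "Suc k"] k by (simp add: u_Suc)
      finally show ?thesis by (simp add: power2_eq_square algebra_simps)
    qed
    have Cn: "C n * B (n - 1) = ((m n)\<^sup>2 - 1) / (2 * h)" using CB[of n] un by simp
    also have "\<dots> = real n * (1 + real n * h / 2)"
      using h_pos by (simp add: m_def power2_eq_square field_simps)
    finally show Cn': "C n * B (n - 1) = real n * (1 + real n * h / 2)" .
    obtain i where i: "n = Suc i" using n by (cases n) auto
    \<comment> \<open>With \<open>u i = r * m n\<close> from the root equation,
      \<open>h * (B (n - 1) * s n)\<close> becomes \<open>real n * m n\<close>; subtracting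
      \<open>2 * (C n * B (n - 1))\<close> leaves \<open>- real n\<close>.\<close>
    have "m i + u i = h * (m n - 1)"
    proof -
      have "m n = q * u i" using un by (simp add: i u_Suc)
      then have "u i = r * m n" using q(2) by (simp flip: mult.assoc)
      moreover have "m i = m n - h" by (simp add: i m_Suc)
      ultimately show ?thesis by (simp add: h algebra_simps)
    qed
    moreover have "B (n - 1) = t i" by (simp add: i B_def t_def)
    moreover have "m n - 1 = h * real n" by (simp add: m_def)
    ultimately have "B (n - 1) * s n = K * (2 * m n * (h * (h * real n)))"
      using z[of i] un lessI[of i] by (simp add: i[symmetric] mult.commute)
    then have "h * (B (n - 1) * s n) = real n * m n"
      using h_pos by (simp add: K_def power3_eq_cube)
    then show "B (n - 1) * (\<Sum>j<n. C j + r * C (Suc j)) - C n * B (n - 1) = - real n"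
      using Cn' unfolding a by (simp add: m_def algebra_simps)
  qed
qed

section \<open>From the weights to the bound along the trajectory\<close>

theorem corollary5p3:
  fixes f :: "'a::euclidean_space \<Rightarrow> real"
    and \<phi> :: "'a \<Rightarrow> ereal"
    and x y :: "nat \<Rightarrow> 'a"
    and n :: nat
    and r h :: real
  assumes "n \<ge> 1"
    and "0 < r" and "r < 1" and "r ^ n * (1 + real n * (1 + r)) = 1"
    and "h = 1 + r"
    and "convex_on UNIV f" and "L_smooth 1 f"
    and "is_arg_min f (\<lambda>_. True) 0" and "f 0 = 0"
    and "\<phi> = prox_phi f"
    and "\<And>i. i \<le> n \<Longrightarrow> y i = prox \<phi> (x i)"
    and "\<And>i. i < n \<Longrightarrow> x (Suc i) = x i - h *\<^sub>R (x i - y i)"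
  shows "grad f (x n) = x n - y n \<and>
    ereal (1/2 * (norm (x n))\<^sup>2) + ereal (real n * h) * \<phi> (y n)
      + ereal (real n * h * (1 + real n * h / 2) * (norm (grad f (x n)))\<^sup>2)
    \<le> ereal (1/2 * (norm (x 0))\<^sup>2)"
proof -
  define g where "g i = grad f (x i)" for i
  define p where "p i = f (x i) - 1/2 * (norm (g i))\<^sup>2" for i
  define D where "D = (1 - r) / 2"
  note conv = assms(6) and smooth = assms(7) and h = assms(5) and step = assms(12)
  have y: "y i = x i - g i" if "i \<le> n" for i
    using assms(11)[OF that] by (simp add: g_def assms(10) prox_prox_phi[OF conv smooth])
  have \<phi>: "\<phi> (y i) = ereal (p i)" if "i \<le> n" for i
    unfolding y[OF that] g_def p_def assms(10) by (rule prox_phi_grad_step[OF conv smooth])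
  have y_diff: "y k - y (Suc k) = r *\<^sub>R g k + g (Suc k)" if "k < n" for k
    using that step[OF that] by (simp add: y h algebra_simps)
  have subgrad: "p j + g j \<bullet> (y i - y j) \<le> p i" if "i \<le> n" "j \<le> n" for i j
    using prox_phi_subgradient[OF conv smooth, of "x j" "x i"] that by (simp add: y p_def g_def)
  \<comment> \<open>Subgradient inequality compared with the point 0, where the gradient and hence
    \<phi> vanish.\<close>
  have origin: "p i \<le> g i \<bullet> y i" if "i \<le> n" for i
    using prox_phi_subgradient[OF conv smooth, of "x i" 0] grad_eq_0_at_min[OF conv smooth assms(8)]
      assms(9) that by (simp add: y p_def g_def inner_diff_right)
  obtain C B e :: "nat \<Rightarrow> real" where w: "C 0 = 0" "B n = 0" "e n = 0"
    "\<And>k. k < n \<Longrightarrow> C k \<le> C (Suc k)"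
    "\<And>k. k < n \<Longrightarrow> B (Suc k) \<le> B k"
    "\<And>k. k < n \<Longrightarrow> e k - e (Suc k) = B k + r * B (Suc k)"
    "\<And>k. k < n \<Longrightarrow>
      B (k - 1) * (\<Sum>j<k. C j + r * C (Suc j)) - C k * (B (k - 1) + r * B k)
        + e k * (C (Suc k) - C k) - B k * (\<Sum>j<Suc k. C j + r * C (Suc j)) = 1"
    "\<And>k. k < n \<Longrightarrow> C k * (B (k - 1) + r * B k) = r * B k * (C k + r * C (Suc k)) - D"
    and ends: "B (n - 1) * (\<Sum>j<n. C j + r * C (Suc j)) - C n * B (n - 1) = - real n"
      "C n * B (n - 1) = real n * (1 + real n * h / 2)"
    unfolding D_def using critical_weights[OF assms(1-3) _ h] assms(4) unfolding h by blast
  have weighted: "real n * p n + real n * (1 + real n * h / 2) * (norm (g n))\<^sup>2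
      \<le> (\<Sum>i<n. p i + D * (norm (g i))\<^sup>2)"
    using separable_weights_le[of n y r g p C B e D, OF y_diff subgrad w(1-6) less_imp_le[OF assms(2)] w(7,8)]
    unfolding ends(1) unfolding ends(2) by simp
  \<comment> \<open>Expanding the square of the step; \<open>D\<close> arises from
    \<open>h - h^2 / 2 = h * D\<close>, and \<open>origin\<close> replaces
    \<open>g i \<bullet> y i\<close> by \<open>p i\<close>.\<close>
  have descent: "h * (p i + D * (norm (g i))\<^sup>2) \<le> 1/2 * (norm (x i))\<^sup>2 - 1/2 * (norm (x (Suc i)))\<^sup>2"
    if "i < n" for i
  proof -
    have "x (Suc i) = x i - h *\<^sub>R g i" using step[OF that] that by (simp add: y)
    then have "(norm (x (Suc i)))\<^sup>2 = (norm (x i))\<^sup>2 - 2 * h * (g i \<bullet> x i) + h\<^sup>2 * (norm (g i))\<^sup>2"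
      by (simp add: power2_norm_eq_inner inner_diff_left inner_diff_right
          inner_commute[of "x i" "g i"]) (simp add: power2_eq_square right_diff_distrib)
    moreover have "h * (g i \<bullet> y i) = h * (g i \<bullet> x i) - h * (norm (g i))\<^sup>2"
      using that by (simp add: y inner_diff_right power2_norm_eq_inner right_diff_distrib)
    moreover have "h - h\<^sup>2 / 2 = h * D"
      by (simp add: D_def h power2_eq_square field_simps)
    then have "h * D * (norm (g i))\<^sup>2 = (h - h\<^sup>2 / 2) * (norm (g i))\<^sup>2" by simp
    ultimately have "1/2 * (norm (x i))\<^sup>2 - 1/2 * (norm (x (Suc i)))\<^sup>2
        = h * (g i \<bullet> y i + D * (norm (g i))\<^sup>2)"
      by (simp add: algebra_simps)
    moreover have "h * (p i + D * (norm (g i))\<^sup>2) \<le> h * (g i \<bullet> y i + D * (norm (g i))\<^sup>2)"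
      using origin[of i] that assms(2) by (intro mult_left_mono) (auto simp: h)
    ultimately show ?thesis by simp
  qed
  have "h * (real n * p n + real n * (1 + real n * h / 2) * (norm (g n))\<^sup>2)
      \<le> h * (\<Sum>i<n. p i + D * (norm (g i))\<^sup>2)"
    using weighted assms(2) by (intro mult_left_mono) (auto simp: h)
  also have "\<dots> \<le> (\<Sum>i<n. 1/2 * (norm (x i))\<^sup>2 - 1/2 * (norm (x (Suc i)))\<^sup>2)"
    unfolding sum_distrib_left by (intro sum_mono descent) simp
  also have "\<dots> = 1/2 * (norm (x 0))\<^sup>2 - 1/2 * (norm (x n))\<^sup>2"
    by (rule sum_lessThan_telescope')
  finally have "1/2 * (norm (x n))\<^sup>2 + real n * h * p n
      + real n * h * (1 + real n * h / 2) * (norm (g n))\<^sup>2 \<le> 1/2 * (norm (x 0))\<^sup>2"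
    by (simp add: algebra_simps)
  then have "ereal (1/2 * (norm (x n))\<^sup>2) + ereal (real n * h) * \<phi> (y n)
      + ereal (real n * h * (1 + real n * h / 2) * (norm (grad f (x n)))\<^sup>2)
      \<le> ereal (1/2 * (norm (x 0))\<^sup>2)"
    unfolding \<phi>[OF order_refl] g_def[symmetric]
    by (simp only: times_ereal.simps plus_ereal.simps ereal_less_eq)
  moreover have "grad f (x n) = x n - y n"
    using y[of n] by (simp add: g_def)
  ultimately show ?thesis by blast
qed

end
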